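(* Let $X \subset \mathbb{R}^n$ be a nonempty open set that is star-shaped at the origin, and let $\phi : X \to \mathbb{R}^m$ be any function. Then $\phi$ has a FISCIDS representation, namely the system $$\dot z(\tau) = \xi, \quad z(0) = 0, \qquad y(\tau) = \phi(z(\tau)).$$
   Context: A set $X \subset \mathbb{R}^n$ is star-shaped at $\xi_0$ if $\xi_0 + s(\xi - \xi_0) \in X$ for all $\xi \in X$ and $s \in [0,1]$. FISCIDS representations. Let $\phi : X \to \mathbb{R}^m$ with $X \subset \mathbb{R}^n$ open. Consider an $N$-dimensional system with fixed initial state $z_0 \in \mathbb{R}^N$ (independent of $\xi$) and constant input $\xi \in X$: $$\dot z(\tau) = F(z(\tau))\,\xi, \quad z(0) = z_0, \qquad y(\tau) = h(z(\tau)),$$ where $F : Z \to \mathbb{R}^{N\times n}$ and $h : Z \to \mathbb{R}^m$ are defined on an open set $Z \subset \mathbb{R}^N$ containing $z_0$. Let $z(\tau;\xi)$ and $y(\tau;\xi)$ denote its state trajectory (in $Z$) and output. If for every $\xi \in X$ the trajectory $z(\tau;\xi)$ is defined for all $\tau \in [0,1]$ and $y(1;\xi) = \phi(\xi)$, the system is called a FISCIDS (fixed-initial-state constant-input dynamical system) representation of $\phi$. In the claim, $N = n$, $Z = X$, $F(z)$ is the $n\times n$ identity matrix, $h = \phi$ and $z_0 = 0$. *)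

theory Defs
  imports "HOL-Analysis.Analysis"
begin

definition star_shaped_at :: "(real ^ 'n) set \<Rightarrow> real ^ 'n \<Rightarrow> bool" where
  "star_shaped_at X \<xi>0 \<longleftrightarrow> (\<forall>\<xi>\<in>X. \<forall>s\<in>{0..1}. \<xi>0 + s *\<^sub>R (\<xi> - \<xi>0) \<in> X)"

text \<open>
  \<open>F\<close> is matrix-valued: a value of type \<open>real ^ 'n ^ 'k\<close> has rows indexed by \<open>'k\<close> (the state
  dimension) and columns indexed by \<open>'n\<close> (the input dimension).  The derivative is one-sided
  at the end points of the time interval.
\<close>

definition state_trajectory ::
  "(real ^ 'k) set \<Rightarrow> (real ^ 'k \<Rightarrow> real ^ 'n ^ 'k) \<Rightarrow> real ^ 'k \<Rightarrow> real ^ 'n \<Rightarrow> real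
    \<Rightarrow> (real \<Rightarrow> real ^ 'k) \<Rightarrow> bool" where
  "state_trajectory Z F z0 \<xi> T z \<longleftrightarrow>
     z 0 = z0 \<and>
     (\<forall>\<tau>\<in>{0..T}. z \<tau> \<in> Z \<and>
        (z has_vector_derivative (F (z \<tau>) *v \<xi>)) (at \<tau> within {0..T}))"

text \<open>
  \<open>\<phi>\<close> is only evaluated on \<open>X\<close>, and \<open>F\<close>, \<open>h\<close> only on \<open>Z\<close>.  No regularity of \<open>F\<close> is
  assumed, so the last conjunct is what makes it meaningful to speak of the trajectory
  for the input \<open>\<xi>\<close>: every solution on an initial part \<open>{0..T}\<close> of \<open>{0..1}\<close> is a
  restriction of \<open>z\<close>.
\<close>

definition fiscids_representation ::
  "(real ^ 'n) set \<Rightarrow> (real ^ 'n \<Rightarrow> real ^ 'm)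
    \<Rightarrow> (real ^ 'k) set \<Rightarrow> (real ^ 'k \<Rightarrow> real ^ 'n ^ 'k) \<Rightarrow> (real ^ 'k \<Rightarrow> real ^ 'm) \<Rightarrow> real ^ 'k
    \<Rightarrow> bool" where
  "fiscids_representation X \<phi> Z F h z0 \<longleftrightarrow>
     open X \<and> open Z \<and> z0 \<in> Z \<and>
     (\<forall>\<xi>\<in>X. \<exists>z.
        state_trajectory Z F z0 \<xi> 1 z \<and>
        h (z 1) = \<phi> \<xi> \<and>
        (\<forall>T\<in>{0..1}. \<forall>w. state_trajectory Z F z0 \<xi> T w \<longrightarrow> (\<forall>\<tau>\<in>{0..T}. w \<tau> = z \<tau>)))"

end

theory Submission
  imports Defs
begin

text \<open>With \<open>F\<close> the identity the velocity is the constant \<open>\<xi>\<close>, so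
  the trajectory from 0 is the ray \<open>t *\<^sub>R \<xi>\<close>. Star-shapedness keeps it in
  \<open>X\<close> for t in [0,1], and at time 1 it reaches \<open>\<xi>\<close>, where the output
  is \<open>\<phi> \<xi>\<close>. Uniqueness: subtracting \<open>t *\<^sub>R \<xi>\<close> from any
  solution leaves a function with zero derivative on an interval, hence a constant, namely the
  initial state.\<close>

lemma state_trajectory_mat_1_unique:
  fixes w :: "real \<Rightarrow> real ^ 'n"
  assumes "state_trajectory Z (\<lambda>z. mat 1) z0 \<xi> T w" and "\<tau> \<in> {0..T}"
  shows "w \<tau> = z0 + \<tau> *\<^sub>R \<xi>"
proof -
  have "((\<lambda>t. w t - t *\<^sub>R \<xi>) has_vector_derivative 0) (at t within {0..T})"
    if "t \<in> {0..T}" for t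
  proof -
    have "(w has_vector_derivative \<xi>) (at t within {0..T})"
      using assms(1) that by (simp add: state_trajectory_def)
    then show ?thesis
      by (auto intro!: derivative_eq_intros)
  qed
  then obtain c where c: "\<And>t. t \<in> {0..T} \<Longrightarrow> w t - t *\<^sub>R \<xi> = c"
    using has_vector_derivative_zero_constant[of "{0..T}" "\<lambda>t. w t - t *\<^sub>R \<xi>"]
    by (metis convex_real_interval(5))
  \<comment> \<open>Time 0 lies in \<open>{0..T}\<close> because the assumption on
    \<open>\<tau>\<close> forces 0 \<le> T.\<close>
  from c[of 0] have "c = z0"
    using assms by (simp add: state_trajectory_def)
  with c[OF assms(2)] show ?thesis
    by (simp add: algebra_simps)
qed

theorem theorem1:
  fixes X :: "(real ^ 'n) set" and \<phi> :: "real ^ 'n \<Rightarrow> real ^ 'm"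
  assumes "X \<noteq> {}" and "open X" and "star_shaped_at X 0"
  shows "fiscids_representation X \<phi> X (\<lambda>z. mat 1) \<phi> 0"
proof -
  have ray: "s *\<^sub>R \<xi> \<in> X" if "\<xi> \<in> X" "s \<in> {0..1}" for s \<xi>
    using assms(3) that by (auto simp: star_shaped_at_def)
  \<comment> \<open>Scaling any point of the nonempty \<open>X\<close> by s = 0 gives the origin, so
    the initial state is admissible.\<close>
  have "0 \<in> X"
    using assms(1) ray[of _ 0] by auto
  moreover have "state_trajectory X (\<lambda>z. mat 1) 0 \<xi> 1 (\<lambda>t. t *\<^sub>R \<xi>)" if "\<xi> \<in> X" for \<xi>
    using ray[OF that]
    by (auto simp: state_trajectory_def intro!: derivative_eq_intros)
  ultimately show ?thesis
    unfolding fiscids_representation_def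
    using assms(2) state_trajectory_mat_1_unique[of X 0]
    \<comment> \<open>The hole in the witness is the input \<open>\<xi>\<close>; for
      \<open>z0 = 0\<close> the formula of the uniqueness lemma is exactly this ray.\<close>
    by (fastforce intro!: exI[of _ "\<lambda>t. t *\<^sub>R _"])
qed

end
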